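(* Let $\langle\rho,P\rangle$ be a configuration with $(\Sigma_\rho,\Sigma_P)\vdash\langle\rho,P\rangle$, let $s$ be a scheduler, and suppose $\langle\rho,P\rangle\xrightarrow{\tau}_{s}\Delta$. Then $(\Sigma_\rho,\Sigma_P)\vdash\Delta$.
   Context: Notation. For a set $S$, $\mathcal D(S)$ is the set of finitely supported probability distributions on $S$; $\overline{s}$ is the point distribution at $s$; $\sum_{i}p_i\bullet\Delta_i$ is a convex combination of distributions ($p_i\ge 0$, $\sum_i p_i=1$). Qubit names range over a denumerable set $\mathcal Q$; for a finite $\Sigma\subseteq\mathcal Q$, $\mathcal H_\Sigma=(\mathbb C^2)^{\otimes|\Sigma|}$. A superoperator with Kraus operators $\{E_i\}$ maps $\rho\mapsto\sum_iE_i\rho E_i^\dagger$; it is trace-preserving if $\sum_iE_i^\dagger E_i=\mathbb I$. A measurement is $\mathbb M=\{M_m\}_{m=0}^{k-1}$ with $\sum_mM_m^\dagger M_m=\mathbb I$, and $\mathcal M_m(\sigma)=M_m\sigma M_m^\dagger$. For a superoperator $\mathcal E$ on $n$ qubits and a tuple $\tilde q$ of $n$ distinct qubit names of $\rho$, $\mathcal E^{\tilde q}$ applies $\mathcal E$ to the qubits $\tilde q$ and the identity to the remaining ones. Syntax (tagged lqCCS). Tags $t$ range over a denumerable set $\mathit{Tag}$; each channel $c$ has a type $\widehat{\mathbb N}$, $\widehat{\mathbb B}$ or $\widehat{\mathcal Q}$. Processes: $P::=t:\tau.P\mid (t,t'):\tau.P\mid t:\mathcal E(\tilde e).P\mid t:\mathbb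 M(\tilde e\rhd x).P\mid t:c?x.P\mid \mathbf 0_{\tilde e}\mid t:c!e.P\mid \mathrm{if}\ e\ \mathrm{then}\ P\ \mathrm{else}\ P\mid P+P\mid P\parallel P\mid P\setminus c$, with expressions $e::=x\mid b\mid n\mid q\mid\neg e\mid e\lor e\mid e\le e\mid e=e$ ($b$ Boolean, $n\in\mathbb N$, $q\in\mathcal Q$), $\mathcal E$ a trace-preserving superoperator of arity $n$ and $\mathbb M$ a measurement on $n$ qubits. Closed expressions evaluate, $e\Downarrow v$, to values (naturals, Booleans, qubit names); $q=q'$ compares names. Typing. Judgement $\Sigma\vdash P$ ($\Sigma$ a set of qubit names/quantum variables): $\Sigma\vdash\mathbf 0_{\tilde e}$ if $\tilde e$ enumerates $\Sigma$; $\tau$-prefixes and restriction keep the context of the continuation; $\Sigma\vdash P+Q$ and $\Sigma\vdash\mathrm{if}\ e\ \mathrm{then}\ P\ \mathrm{else}\ Q$ ($e$ Boolean) if $\Sigma\vdash P$ and $\Sigma\vdash Q$; $\Sigma\vdash t:\mathcal E(\tilde e).P$ and $\Sigma\vdash t:\mathbb M(\tilde e\rhd y).P$ ($y$ natural) if $\tilde e$ enumerates a set $E\subseteq\Sigma$ of size the arity and $\Sigma\vdash P$; classical receive/send on a channel of type $\widehat T$, $T\in\{\mathbb B,\mathbb N\}$, with variable/expression of type $T$: $\Sigma\vdash P$; $\Sigma\vdash t:c?x.P$ with $c:\widehat{\mathcal Q}$, $x:\mathcal Q$ if $\Sigma\cup\{x\}\vdash P$; $\Sigma\vdash t:c!e.P$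 with $c:\widehat{\mathcal Q}$ if $e\in\Sigma$ and $\Sigma\setminus\{e\}\vdash P$; $\Sigma_1\cup\Sigma_2\vdash P_1\parallel P_2$ if $\Sigma_1\cap\Sigma_2=\emptyset$ and $\Sigma_i\vdash P_i$. Typing is unique; $\Sigma_P$ denotes the context typing $P$. Configurations. $\langle\rho,P\rangle$ with $P$ closed and $\rho$ a density operator on $\mathcal H_{\Sigma_\rho}$; $(\Sigma_\rho,\Sigma_P)\vdash\langle\rho,P\rangle$ if $\Sigma_P\subseteq\Sigma_\rho$; for $\Delta\in\mathcal D(\mathit{Conf})$, $(\Sigma,\Sigma')\vdash\Delta$ if every configuration in its support is so typed. Semantics. Schedulers: $s::=h\mid t\mid (t,t')$. Actions: $\tau$, $c!v$, $c?v$. The transition relation $\langle\rho,P\rangle\xrightarrow{\mu}_s\Delta$ ($\Delta\in\mathcal D(\mathit{Conf})$) is the least relation with: $\langle\rho,t:\tau.P\rangle\xrightarrow{\tau}_t\overline{\langle\rho,P\rangle}$; $\langle\rho,(t,t'):\tau.P\rangle\xrightarrow{\tau}_{(t,t')}\overline{\langle\rho,P\rangle}$; $\langle\rho,t:c!e.P\rangle\xrightarrow{c!v}_t\overline{\langle\rho,P\rangle}$ if $e\Downarrow v$; $\langle\rho,t:c?x.P\rangle\xrightarrow{c?v}_t\overline{\langle\rho,P[v/x]\rangle}$ (with $v\in\Sigma_\rho$ if $c:\widehat{\mathcal Q}$); $\langle\rho,t:\mathcal E(\tilde q).P\rangle\xrightarrow{\tau}_t\overline{\langle\mathcal E^{\tilde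 q}(\rho),P\rangle}$; $\langle\rho,t:\mathbb M(\tilde q\rhd y).P\rangle\xrightarrow{\tau}_t\sum_mp_m\bullet\overline{\langle\mathcal M_m^{\tilde q}(\rho)/p_m,P[m/y]\rangle}$ with $p_m=\mathrm{tr}(\mathcal M^{\tilde q}_m(\rho))$; $\mathrm{if}\ e\ \mathrm{then}\ P\ \mathrm{else}\ Q$ has the transitions of $P$ if $e\Downarrow\mathit{tt}$ and of $Q$ if $e\Downarrow\mathit{ff}$; $P+Q$ has the transitions of $P$ and of $Q$; if $\langle\rho,P\rangle\xrightarrow{\mu}_s\Delta$ with $\mu\notin\{c!v,c?v\}$ then $\langle\rho,P\setminus c\rangle\xrightarrow{\mu}_s\Delta\setminus c$; if $\langle\rho,P\rangle\xrightarrow{\mu}_s\Delta$ and $\mu$ is not of the form $c?v$ with $v\in\Sigma_Q$ then $\langle\rho,P\parallel Q\rangle\xrightarrow{\mu}_s\Delta\parallel Q$ (and symmetrically for the right component); if $\langle\rho,P\rangle\xrightarrow{c!v}_t\overline{\langle\rho,P'\rangle}$ and $\langle\rho,Q\rangle\xrightarrow{c?v}_{t'}\overline{\langle\rho,Q'\rangle}$ then $\langle\rho,P\parallel Q\rangle\xrightarrow{\tau}_{(t,t')}\overline{\langle\rho,P'\parallel Q'\rangle}$ and $\langle\rho,Q\parallel P\rangle\xrightarrow{\tau}_{(t,t')}\overline{\langle\rho,Q'\parallel P'\rangle}$. Here $\Delta\parallel Q$ and $\Delta\setminus c$ are applied pointwise to the support.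
   Formalization: In the typing rule for receiving a qubit, c?x.P, the bound variable x is additionally required not to be in Σ already; without this, typing is not unique and the claim fails, e.g. for c!q.0 ∥ c?x.d?x.0_x. *)

theory Defs
  imports
    "HOL-Probability.Probability_Mass_Function"
    "Jordan_Normal_Form.Schur_Decomposition"
begin

section \<open>Matrices on qubits\<close>

type_synonym qubit = nat

definition mat_sum :: "nat \<Rightarrow> complex mat list \<Rightarrow> complex mat" where
  "mat_sum d As = foldr (+) As (0\<^sub>m d d)"

definition mat_trace :: "complex mat \<Rightarrow> complex" where
  "mat_trace A = (\<Sum>i<dim_row A. A $$ (i, i))"

text \<open>
  The order on \<open>complex\<close> makes \<open>0 \<le> z\<close> say that \<open>z\<close> is real and nonnegative, so the second
  conjunct below is positive semidefiniteness (which over the complex numbers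
  includes being Hermitian).
\<close>

definition density_operator :: "nat \<Rightarrow> complex mat \<Rightarrow> bool" where
  "density_operator d A \<longleftrightarrow>
     A \<in> carrier_mat d d \<and>
     (\<forall>v \<in> carrier_vec d. 0 \<le> (A *\<^sub>v v) \<bullet>c v) \<and>
     mat_trace A = 1"

definition complete_family :: "nat \<Rightarrow> complex mat list \<Rightarrow> bool" where
  "complete_family n As \<longleftrightarrow>
     set As \<subseteq> carrier_mat (2 ^ n) (2 ^ n) \<and>
     mat_sum (2 ^ n) (map (\<lambda>A. mat_adjoint A * A) As) = 1\<^sub>m (2 ^ n)"

lemma complete_family_identity: "complete_family 0 [1\<^sub>m 1]"
proof -
  have "mat_adjoint (1\<^sub>m 1 :: complex mat) = 1\<^sub>m 1"
    by (intro eq_matI) (auto simp: mat_adjoint_def mat_of_rows_def)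
  then show ?thesis
    by (simp add: complete_family_def mat_sum_def)
qed

text \<open>
  A trace-preserving superoperator is given by its arity and a family of Kraus operators, a
  measurement by its arity and the family of its measurement operators; outcome \<open>m\<close> is position
  \<open>m\<close> of the list.
\<close>

typedef superop = "{(n, Es). complete_family n Es}"
  using complete_family_identity by blast

typedef measurement = "{(n, Ms). complete_family n Ms}"
  using complete_family_identity by blast

definition superop_arity :: "superop \<Rightarrow> nat" where
  "superop_arity \<E> = fst (Rep_superop \<E>)"

definition kraus :: "superop \<Rightarrow> complex mat list" where
  "kraus \<E> = snd (Rep_superop \<E>)"

definition meas_arity :: "measurement \<Rightarrow> nat" where
  "meas_arity \<M> = fst (Rep_measurement \<M>)"

definition meas_ops :: "measurement \<Rightarrow> complex mat list" where
  "meas_ops \<M> = snd (Rep_measurement \<M>)"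

text \<open>
  The space of a finite set \<open>S\<close> of qubit names is the tensor product of \<open>card S\<close> copies of
  \<open>\<complex>\<^sup>2\<close>, the factors being listed by increasing name. Its computational basis is indexed by
  \<open>0, \<dots>, 2 ^ card S - 1\<close>, the first factor providing the most significant bit (the usual
  convention for Kronecker products). \<open>qubit_bit S q k\<close> is the bit of basis index \<open>k\<close>
  belonging to qubit \<open>q\<close>, and \<open>tuple_index S qs k\<close> is the index of the bits of \<open>k\<close> at the
  tuple \<open>qs\<close> in the basis of \<open>length qs\<close> qubits.
\<close>

definition qubit_bit :: "qubit set \<Rightarrow> qubit \<Rightarrow> nat \<Rightarrow> nat" where
  "qubit_bit S q k = (k div 2 ^ card {r \<in> S. q < r}) mod 2"

definition tuple_index :: "qubit set \<Rightarrow> qubit list \<Rightarrow> nat \<Rightarrow> nat" where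
  "tuple_index S qs k = (\<Sum>i<length qs. qubit_bit S (qs ! i) k * 2 ^ (length qs - 1 - i))"

text \<open>\<open>A\<close> on the qubits \<open>qs\<close>, tensored with the identity on the other qubits of \<open>S\<close>.\<close>

definition on_qubits :: "qubit set \<Rightarrow> qubit list \<Rightarrow> complex mat \<Rightarrow> complex mat" where
  "on_qubits S qs A = mat (2 ^ card S) (2 ^ card S)
     (\<lambda>(k, l). if \<forall>r \<in> S - set qs. qubit_bit S r k = qubit_bit S r l
               then A $$ (tuple_index S qs k, tuple_index S qs l) else 0)"

definition sandwich :: "complex mat \<Rightarrow> complex mat \<Rightarrow> complex mat" where
  "sandwich A \<rho> = A * \<rho> * mat_adjoint A"

datatype qstate = QState (qubits: "qubit set") (op: "complex mat")

definition is_density :: "qstate \<Rightarrow> bool" where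
  "is_density \<rho> \<longleftrightarrow> finite (qubits \<rho>) \<and> density_operator (2 ^ card (qubits \<rho>)) (op \<rho>)"

definition apply_superop :: "superop \<Rightarrow> qubit list \<Rightarrow> qstate \<Rightarrow> qstate" where
  "apply_superop \<E> qs \<rho> = QState (qubits \<rho>)
     (mat_sum (2 ^ card (qubits \<rho>))
        (map (\<lambda>E. sandwich (on_qubits (qubits \<rho>) qs E) (op \<rho>)) (kraus \<E>)))"

definition meas_branch :: "measurement \<Rightarrow> qubit list \<Rightarrow> nat \<Rightarrow> qstate \<Rightarrow> complex mat" where
  "meas_branch \<M> qs m \<rho> = sandwich (on_qubits (qubits \<rho>) qs (meas_ops \<M> ! m)) (op \<rho>)"

definition meas_prob :: "measurement \<Rightarrow> qubit list \<Rightarrow> nat \<Rightarrow> qstate \<Rightarrow> real" where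
  "meas_prob \<M> qs m \<rho> = Re (mat_trace (meas_branch \<M> qs m \<rho>))"

definition meas_state :: "measurement \<Rightarrow> qubit list \<Rightarrow> nat \<Rightarrow> qstate \<Rightarrow> qstate" where
  "meas_state \<M> qs m \<rho> = QState (qubits \<rho>)
     (complex_of_real (1 / meas_prob \<M> qs m \<rho>) \<cdot>\<^sub>m meas_branch \<M> qs m \<rho>)"


section \<open>Syntax\<close>

type_synonym tag = nat

datatype ty = TNat | TBool | TQubit

text \<open>There are denumerably many channels and variables of each type.\<close>

datatype chan = Chan (chan_ty: ty) (chan_name: nat)

datatype var = Var (var_ty: ty) (var_name: nat)

datatype val = VNat nat | VBool bool | VQubit qubit

datatype expr =
    EVar var
  | EVal val
  | ENot expr
  | EOr expr expr
  | ELe expr expr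
  | EEq expr expr

datatype proc =
    Tau tag proc
  | TauPair tag tag proc
  | Sop tag superop "expr list" proc
  | Meas tag measurement "expr list" var proc
  | Recv tag chan var proc
  | Zero "expr list"
  | Send tag chan expr proc
  | Cond expr proc proc
  | Choice proc proc
  | Par proc proc
  | Res proc chan

abbreviation EQubit :: "qubit \<Rightarrow> expr" where
  "EQubit q \<equiv> EVal (VQubit q)"

fun expr_fv :: "expr \<Rightarrow> var set" where
  "expr_fv (EVar x) = {x}"
| "expr_fv (EVal v) = {}"
| "expr_fv (ENot e) = expr_fv e"
| "expr_fv (EOr e f) = expr_fv e \<union> expr_fv f"
| "expr_fv (ELe e f) = expr_fv e \<union> expr_fv f"
| "expr_fv (EEq e f) = expr_fv e \<union> expr_fv f"

fun fv :: "proc \<Rightarrow> var set" where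
  "fv (Tau t P) = fv P"
| "fv (TauPair t t' P) = fv P"
| "fv (Sop t \<E> es P) = (\<Union>e \<in> set es. expr_fv e) \<union> fv P"
| "fv (Meas t \<M> es y P) = (\<Union>e \<in> set es. expr_fv e) \<union> (fv P - {y})"
| "fv (Recv t c x P) = fv P - {x}"
| "fv (Zero es) = (\<Union>e \<in> set es. expr_fv e)"
| "fv (Send t c e P) = expr_fv e \<union> fv P"
| "fv (Cond e P Q) = expr_fv e \<union> fv P \<union> fv Q"
| "fv (Choice P Q) = fv P \<union> fv Q"
| "fv (Par P Q) = fv P \<union> fv Q"
| "fv (Res P c) = fv P"

definition closed_proc :: "proc \<Rightarrow> bool" where
  "closed_proc P \<longleftrightarrow> fv P = {}"

text \<open>
  Only values, which have no free variables, are ever substituted, so there is no capture and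
  no renaming of bound variables.
\<close>

fun expr_subst :: "expr \<Rightarrow> val \<Rightarrow> var \<Rightarrow> expr" where
  "expr_subst (EVar z) v x = (if z = x then EVal v else EVar z)"
| "expr_subst (EVal w) v x = EVal w"
| "expr_subst (ENot e) v x = ENot (expr_subst e v x)"
| "expr_subst (EOr e f) v x = EOr (expr_subst e v x) (expr_subst f v x)"
| "expr_subst (ELe e f) v x = ELe (expr_subst e v x) (expr_subst f v x)"
| "expr_subst (EEq e f) v x = EEq (expr_subst e v x) (expr_subst f v x)"

fun subst :: "proc \<Rightarrow> val \<Rightarrow> var \<Rightarrow> proc" where
  "subst (Tau t P) v x = Tau t (subst P v x)"
| "subst (TauPair t t' P) v x = TauPair t t' (subst P v x)"
| "subst (Sop t \<E> es P) v x = Sop t \<E> (map (\<lambda>e. expr_subst e v x) es) (subst P v x)"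
| "subst (Meas t \<M> es y P) v x =
     Meas t \<M> (map (\<lambda>e. expr_subst e v x) es) y (if y = x then P else subst P v x)"
| "subst (Recv t c y P) v x = Recv t c y (if y = x then P else subst P v x)"
| "subst (Zero es) v x = Zero (map (\<lambda>e. expr_subst e v x) es)"
| "subst (Send t c e P) v x = Send t c (expr_subst e v x) (subst P v x)"
| "subst (Cond e P Q) v x = Cond (expr_subst e v x) (subst P v x) (subst Q v x)"
| "subst (Choice P Q) v x = Choice (subst P v x) (subst Q v x)"
| "subst (Par P Q) v x = Par (subst P v x) (subst Q v x)"
| "subst (Res P c) v x = Res (subst P v x) c"

inductive eval :: "expr \<Rightarrow> val \<Rightarrow> bool" (infix \<open>\<Down>\<close> 55) where
  "EVal v \<Down> v"
| "e \<Down> VBool a \<Longrightarrow> ENot e \<Down> VBool (\<not> a)"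
| "\<lbrakk> e \<Down> VBool a; f \<Down> VBool b \<rbrakk> \<Longrightarrow> EOr e f \<Down> VBool (a \<or> b)"
| "\<lbrakk> e \<Down> VNat m; f \<Down> VNat n \<rbrakk> \<Longrightarrow> ELe e f \<Down> VBool (m \<le> n)"
| "\<lbrakk> e \<Down> v; f \<Down> w \<rbrakk> \<Longrightarrow> EEq e f \<Down> VBool (v = w)"


section \<open>Typing\<close>

fun val_ty :: "val \<Rightarrow> ty" where
  "val_ty (VNat n) = TNat"
| "val_ty (VBool b) = TBool"
| "val_ty (VQubit q) = TQubit"

inductive expr_typed :: "expr \<Rightarrow> ty \<Rightarrow> bool" where
  "expr_typed (EVar x) (var_ty x)"
| "expr_typed (EVal v) (val_ty v)"
| "expr_typed e TBool \<Longrightarrow> expr_typed (ENot e) TBool"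
| "\<lbrakk> expr_typed e TBool; expr_typed f TBool \<rbrakk> \<Longrightarrow> expr_typed (EOr e f) TBool"
| "\<lbrakk> expr_typed e TNat; expr_typed f TNat \<rbrakk> \<Longrightarrow> expr_typed (ELe e f) TBool"
| "\<lbrakk> expr_typed e T; expr_typed f T \<rbrakk> \<Longrightarrow> expr_typed (EEq e f) TBool"

text \<open>
  A context is a set of qubit names and quantum variables, i.e. of expressions of type
  \<open>TQubit\<close>: no compound expression has that type. In the rule for receiving qubits, the bound
  variable must not already be in the context (otherwise typing would not be unique and a
  shadowed quantum variable could occur in a context).
\<close>

inductive typed :: "expr set \<Rightarrow> proc \<Rightarrow> bool" (infix \<open>\<turnstile>\<close> 50) where
  typed_Zero: "\<lbrakk> distinct es; set es = \<Sigma>; \<forall>e \<in> set es. expr_typed e TQubit \<rbrakk> \<Longrightarrow> \<Sigma> \<turnstile> Zero es"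
| typed_Tau: "\<Sigma> \<turnstile> P \<Longrightarrow> \<Sigma> \<turnstile> Tau t P"
| typed_TauPair: "\<Sigma> \<turnstile> P \<Longrightarrow> \<Sigma> \<turnstile> TauPair t t' P"
| typed_Res: "\<Sigma> \<turnstile> P \<Longrightarrow> \<Sigma> \<turnstile> Res P c"
| typed_Choice: "\<lbrakk> \<Sigma> \<turnstile> P; \<Sigma> \<turnstile> Q \<rbrakk> \<Longrightarrow> \<Sigma> \<turnstile> Choice P Q"
| typed_Cond: "\<lbrakk> expr_typed e TBool; \<Sigma> \<turnstile> P; \<Sigma> \<turnstile> Q \<rbrakk> \<Longrightarrow> \<Sigma> \<turnstile> Cond e P Q"
| typed_Sop: "\<lbrakk> distinct es; length es = superop_arity \<E>; set es \<subseteq> \<Sigma>; \<Sigma> \<turnstile> P \<rbrakk>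
    \<Longrightarrow> \<Sigma> \<turnstile> Sop t \<E> es P"
| typed_Meas: "\<lbrakk> distinct es; length es = meas_arity \<M>; set es \<subseteq> \<Sigma>; var_ty y = TNat; \<Sigma> \<turnstile> P \<rbrakk>
    \<Longrightarrow> \<Sigma> \<turnstile> Meas t \<M> es y P"
| typed_Recv_classical: "\<lbrakk> chan_ty c = T; T \<in> {TBool, TNat}; var_ty x = T; \<Sigma> \<turnstile> P \<rbrakk>
    \<Longrightarrow> \<Sigma> \<turnstile> Recv t c x P"
| typed_Send_classical: "\<lbrakk> chan_ty c = T; T \<in> {TBool, TNat}; expr_typed e T; \<Sigma> \<turnstile> P \<rbrakk>
    \<Longrightarrow> \<Sigma> \<turnstile> Send t c e P"
| typed_Recv_qubit: "\<lbrakk> chan_ty c = TQubit; var_ty x = TQubit; EVar x \<notin> \<Sigma>; \<Sigma> \<union> {EVar x} \<turnstile> P \<rbrakk>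
    \<Longrightarrow> \<Sigma> \<turnstile> Recv t c x P"
| typed_Send_qubit: "\<lbrakk> chan_ty c = TQubit; e \<in> \<Sigma>; \<Sigma> - {e} \<turnstile> P \<rbrakk> \<Longrightarrow> \<Sigma> \<turnstile> Send t c e P"
| typed_Par: "\<lbrakk> \<Sigma>\<^sub>1 \<inter> \<Sigma>\<^sub>2 = {}; \<Sigma>\<^sub>1 \<turnstile> P\<^sub>1; \<Sigma>\<^sub>2 \<turnstile> P\<^sub>2 \<rbrakk> \<Longrightarrow> \<Sigma>\<^sub>1 \<union> \<Sigma>\<^sub>2 \<turnstile> Par P\<^sub>1 P\<^sub>2"

inductive_cases typed_ZeroE: "\<Sigma> \<turnstile> Zero es"
inductive_cases typed_TauE: "\<Sigma> \<turnstile> Tau t P"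
inductive_cases typed_TauPairE: "\<Sigma> \<turnstile> TauPair t t' P"
inductive_cases typed_ResE: "\<Sigma> \<turnstile> Res P c"
inductive_cases typed_ChoiceE: "\<Sigma> \<turnstile> Choice P Q"
inductive_cases typed_CondE: "\<Sigma> \<turnstile> Cond e P Q"
inductive_cases typed_SopE: "\<Sigma> \<turnstile> Sop t \<E> es P"
inductive_cases typed_MeasE: "\<Sigma> \<turnstile> Meas t \<M> es y P"
inductive_cases typed_RecvE: "\<Sigma> \<turnstile> Recv t c x P"
inductive_cases typed_SendE: "\<Sigma> \<turnstile> Send t c e P"
inductive_cases typed_ParE: "\<Sigma> \<turnstile> Par P Q"

lemma typed_unique: "\<lbrakk> \<Sigma> \<turnstile> P; \<Sigma>' \<turnstile> P \<rbrakk> \<Longrightarrow> \<Sigma>' = \<Sigma>"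
proof (induction P arbitrary: \<Sigma> \<Sigma>')
  case (Zero es)
  then show ?case by (metis typed_ZeroE)
next
  case (Recv t c x P)
  show ?case
  proof (cases "chan_ty c = TQubit")
    case True
    have *: "EVar x \<notin> \<Gamma> \<and> insert (EVar x) \<Gamma> \<turnstile> P" if "\<Gamma> \<turnstile> Recv t c x P" for \<Gamma>
      using that True by (elim typed_RecvE) simp_all
    show ?thesis using Recv.IH *[OF Recv.prems(1)] *[OF Recv.prems(2)] by (metis insert_ident)
  next
    case False
    have *: "\<Gamma> \<turnstile> P" if "\<Gamma> \<turnstile> Recv t c x P" for \<Gamma>
      using that False by (elim typed_RecvE) simp_all
    show ?thesis using Recv.IH * Recv.prems by blast
  qed
next
  case (Send t c e P)
  show ?case
  proof (cases "chan_ty c = TQubit")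
    case True
    have *: "e \<in> \<Gamma> \<and> \<Gamma> - {e} \<turnstile> P" if "\<Gamma> \<turnstile> Send t c e P" for \<Gamma>
      using that True by (elim typed_SendE) simp_all
    show ?thesis using Send.IH *[OF Send.prems(1)] *[OF Send.prems(2)] by (metis insert_Diff)
  next
    case False
    have *: "\<Gamma> \<turnstile> P" if "\<Gamma> \<turnstile> Send t c e P" for \<Gamma>
      using that False by (elim typed_SendE) simp_all
    show ?thesis using Send.IH * Send.prems by blast
  qed
next
  case (Par P Q)
  then show ?case by (metis typed_ParE)
qed (metis typed_TauE typed_TauPairE typed_ResE typed_ChoiceE typed_CondE typed_SopE typed_MeasE)+

definition ctx :: "proc \<Rightarrow> expr set" where
  "ctx P = (THE \<Sigma>. \<Sigma> \<turnstile> P)"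

lemma ctx_eq: "\<Sigma> \<turnstile> P \<Longrightarrow> ctx P = \<Sigma>"
  unfolding ctx_def by (rule the_equality, assumption, erule (1) typed_unique)


section \<open>Configurations\<close>

datatype conf = Conf (state: qstate) (proc: proc)  (\<open>\<langle>_, _\<rangle>\<close>)

text \<open>Contexts of closed processes are given here by their sets of qubit names.\<close>

definition conf_typed :: "qubit set \<Rightarrow> qubit set \<Rightarrow> conf \<Rightarrow> bool" where
  "conf_typed \<Sigma>\<^sub>\<rho> \<Sigma>\<^sub>P C \<longleftrightarrow>
     is_density (state C) \<and> closed_proc (proc C) \<and>
     qubits (state C) = \<Sigma>\<^sub>\<rho> \<and> EQubit ` \<Sigma>\<^sub>P \<turnstile> proc C \<and> \<Sigma>\<^sub>P \<subseteq> \<Sigma>\<^sub>\<rho>"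

definition dist_typed :: "qubit set \<Rightarrow> qubit set \<Rightarrow> conf pmf \<Rightarrow> bool" where
  "dist_typed \<Sigma> \<Sigma>' \<Delta> \<longleftrightarrow> finite (set_pmf \<Delta>) \<and> (\<forall>C \<in> set_pmf \<Delta>. conf_typed \<Sigma> \<Sigma>' C)"


section \<open>Semantics\<close>

datatype sched = SHalt | STag tag | SPair tag tag

datatype act = ATau | AOut chan val | AIn chan val

text \<open>The value of \<open>\<mu>\<close>, if it is an input of a qubit name, is not in the context of \<open>Q\<close>.\<close>

definition input_avoids :: "act \<Rightarrow> proc \<Rightarrow> bool" where
  "input_avoids \<mu> Q \<longleftrightarrow> (\<forall>c v. \<mu> = AIn c v \<longrightarrow> EVal v \<notin> ctx Q)"

definition par_left :: "proc \<Rightarrow> conf \<Rightarrow> conf" where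
  "par_left Q C = \<langle>state C, Par (proc C) Q\<rangle>"

definition par_right :: "proc \<Rightarrow> conf \<Rightarrow> conf" where
  "par_right P C = \<langle>state C, Par P (proc C)\<rangle>"

definition res_conf :: "chan \<Rightarrow> conf \<Rightarrow> conf" where
  "res_conf c C = \<langle>state C, Res (proc C) c\<rangle>"

text \<open>
  The convex combination in the rule for measurements weighs the point distribution at
  the configuration of outcome \<open>m\<close> with \<open>meas_prob \<M> qs m \<rho>\<close>. Equal configurations have their
  weights added, and outcomes of probability \<open>0\<close> are not in the support.
\<close>

inductive step :: "conf \<Rightarrow> act \<Rightarrow> sched \<Rightarrow> conf pmf \<Rightarrow> bool" where
  step_Tau: "step \<langle>\<rho>, Tau t P\<rangle> ATau (STag t) (return_pmf \<langle>\<rho>, P\<rangle>)"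
| step_TauPair: "step \<langle>\<rho>, TauPair t t' P\<rangle> ATau (SPair t t') (return_pmf \<langle>\<rho>, P\<rangle>)"
| step_Send: "e \<Down> v \<Longrightarrow> step \<langle>\<rho>, Send t c e P\<rangle> (AOut c v) (STag t) (return_pmf \<langle>\<rho>, P\<rangle>)"
| step_Recv: "(chan_ty c = TQubit \<longrightarrow> v \<in> VQubit ` qubits \<rho>)
    \<Longrightarrow> step \<langle>\<rho>, Recv t c x P\<rangle> (AIn c v) (STag t) (return_pmf \<langle>\<rho>, subst P v x\<rangle>)"
| step_Sop: "step \<langle>\<rho>, Sop t \<E> (map EQubit qs) P\<rangle> ATau (STag t)
    (return_pmf \<langle>apply_superop \<E> qs \<rho>, P\<rangle>)"
| step_Meas: "step \<langle>\<rho>, Meas t \<M> (map EQubit qs) y P\<rangle> ATau (STag t)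
    (pmf_of_list (map (\<lambda>m. (\<langle>meas_state \<M> qs m \<rho>, subst P (VNat m) y\<rangle>, meas_prob \<M> qs m \<rho>))
                      [0..<length (meas_ops \<M>)]))"
| step_Cond_true: "\<lbrakk> e \<Down> VBool True; step \<langle>\<rho>, P\<rangle> \<mu> s \<Delta> \<rbrakk> \<Longrightarrow> step \<langle>\<rho>, Cond e P Q\<rangle> \<mu> s \<Delta>"
| step_Cond_false: "\<lbrakk> e \<Down> VBool False; step \<langle>\<rho>, Q\<rangle> \<mu> s \<Delta> \<rbrakk> \<Longrightarrow> step \<langle>\<rho>, Cond e P Q\<rangle> \<mu> s \<Delta>"
| step_Choice_left: "step \<langle>\<rho>, P\<rangle> \<mu> s \<Delta> \<Longrightarrow> step \<langle>\<rho>, Choice P Q\<rangle> \<mu> s \<Delta>"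
| step_Choice_right: "step \<langle>\<rho>, Q\<rangle> \<mu> s \<Delta> \<Longrightarrow> step \<langle>\<rho>, Choice P Q\<rangle> \<mu> s \<Delta>"
| step_Res: "\<lbrakk> step \<langle>\<rho>, P\<rangle> \<mu> s \<Delta>; \<forall>v. \<mu> \<noteq> AOut c v \<and> \<mu> \<noteq> AIn c v \<rbrakk>
    \<Longrightarrow> step \<langle>\<rho>, Res P c\<rangle> \<mu> s (map_pmf (res_conf c) \<Delta>)"
| step_Par_left: "\<lbrakk> step \<langle>\<rho>, P\<rangle> \<mu> s \<Delta>; input_avoids \<mu> Q \<rbrakk>
    \<Longrightarrow> step \<langle>\<rho>, Par P Q\<rangle> \<mu> s (map_pmf (par_left Q) \<Delta>)"
| step_Par_right: "\<lbrakk> step \<langle>\<rho>, Q\<rangle> \<mu> s \<Delta>; input_avoids \<mu> P \<rbrakk>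
    \<Longrightarrow> step \<langle>\<rho>, Par P Q\<rangle> \<mu> s (map_pmf (par_right P) \<Delta>)"
| step_Comm_left: "\<lbrakk> step \<langle>\<rho>, P\<rangle> (AOut c v) (STag t) (return_pmf \<langle>\<rho>, P'\<rangle>);
                    step \<langle>\<rho>, Q\<rangle> (AIn c v) (STag t') (return_pmf \<langle>\<rho>, Q'\<rangle>) \<rbrakk>
    \<Longrightarrow> step \<langle>\<rho>, Par P Q\<rangle> ATau (SPair t t') (return_pmf \<langle>\<rho>, Par P' Q'\<rangle>)"
| step_Comm_right: "\<lbrakk> step \<langle>\<rho>, P\<rangle> (AOut c v) (STag t) (return_pmf \<langle>\<rho>, P'\<rangle>);
                     step \<langle>\<rho>, Q\<rangle> (AIn c v) (STag t') (return_pmf \<langle>\<rho>, Q'\<rangle>) \<rbrakk>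
    \<Longrightarrow> step \<langle>\<rho>, Par Q P\<rangle> ATau (SPair t t') (return_pmf \<langle>\<rho>, Par Q' P'\<rangle>)"

end

theory Submission
  imports Defs
begin

text \<open>
  Two independent facts make typing survive a transition. First, tensoring with the identity
  preserves completeness of a family of operators: an entry of \<open>A\<^sup>\<dagger> A\<close>, for the extended \<open>A\<close>, is
  a sum over the basis indices that agree with a given one off the tuple \<open>qs\<close>, and reading off
  the bits at \<open>qs\<close> identifies these indices with the basis of \<open>length qs\<close> qubits. Hence
  superoperators preserve the trace and the outcome probabilities of a measurement add up to \<open>1\<close>,
  so that \<open>pmf_of_list\<close> in the measurement rule does not yield a junk value.
  Second, induction on transitions needs all actions: an output of a qubit removes it from the
  context, an input adds it. The semantics does not check the values that are input, so for inputs
  a compatible value is a hypothesis, while for outputs it is a conclusion; in a communication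
  the sender discharges the hypothesis of the receiver.
\<close>

unbundle no vec_syntax


section \<open>Positive semidefinite matrices and traces\<close>

lemma mat_adjoint_dim [simp]: "dim_row (mat_adjoint A) = dim_col A" "dim_col (mat_adjoint A) = dim_row A"
  by (auto simp: mat_adjoint_def)

lemma mat_adjoint_carrier [simp]: "A \<in> carrier_mat m n \<Longrightarrow> mat_adjoint A \<in> carrier_mat n m"
  by auto

lemma index_mat_adjoint [simp]:
  "\<lbrakk> i < dim_col A; j < dim_row A \<rbrakk> \<Longrightarrow> mat_adjoint A $$ (i, j) = conjugate (A $$ (j, i))"
  by (simp add: mat_adjoint_def mat_of_rows_def)

lemma mat_sum_carrier: "set As \<subseteq> carrier_mat d d \<Longrightarrow> mat_sum d As \<in> carrier_mat d d"
  by (induction As) (auto simp: mat_sum_def)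

lemma mat_sum_Cons [simp]: "mat_sum d (A # As) = A + mat_sum d As"
  by (simp add: mat_sum_def)

lemma mat_sum_Nil [simp]: "mat_sum d [] = 0\<^sub>m d d"
  by (simp add: mat_sum_def)

lemma index_mat_sum:
  "\<lbrakk> set As \<subseteq> carrier_mat d d; i < d; j < d \<rbrakk>
    \<Longrightarrow> mat_sum d As $$ (i, j) = (\<Sum>A\<leftarrow>As. A $$ (i, j))"
proof (induction As)
  case (Cons A As)
  then have "mat_sum d As \<in> carrier_mat d d" by (intro mat_sum_carrier) auto
  with Cons show ?case by simp
qed simp

lemma mat_trace_add:
  "\<lbrakk> A \<in> carrier_mat d d; B \<in> carrier_mat d d \<rbrakk> \<Longrightarrow> mat_trace (A + B) = mat_trace A + mat_trace B"
  by (simp add: mat_trace_def sum.distrib)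

lemma mat_trace_sum:
  "set As \<subseteq> carrier_mat d d \<Longrightarrow> mat_trace (mat_sum d As) = (\<Sum>A\<leftarrow>As. mat_trace A)"
proof (induction As)
  case (Cons A As)
  then show ?case by (simp add: mat_trace_add[where d = d] mat_sum_carrier)
qed (simp add: mat_trace_def)

lemma mat_trace_smult: "A \<in> carrier_mat d d \<Longrightarrow> mat_trace (c \<cdot>\<^sub>m A) = c * mat_trace A"
  by (simp add: mat_trace_def sum_distrib_left)

lemma mat_trace_mult_commute:
  assumes "A \<in> carrier_mat m n" "B \<in> carrier_mat n m"
  shows "mat_trace (A * B) = mat_trace (B * A)"
proof -
  have "mat_trace (A * B) = (\<Sum>i<m. \<Sum>j<n. A $$ (i, j) * B $$ (j, i))"
    using assms by (auto simp: mat_trace_def scalar_prod_def atLeast0LessThan intro!: sum.cong)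
  also have "\<dots> = (\<Sum>j<n. \<Sum>i<m. B $$ (j, i) * A $$ (i, j))"
    by (subst sum.swap) (simp add: mult.commute)
  also have "\<dots> = mat_trace (B * A)"
    using assms by (auto simp: mat_trace_def scalar_prod_def atLeast0LessThan intro!: sum.cong)
  finally show ?thesis .
qed

lemma mat_sum_mult_right:
  assumes "set As \<subseteq> carrier_mat d d" "B \<in> carrier_mat d d"
  shows "mat_sum d As * B = mat_sum d (map (\<lambda>A. A * B) As)"
  using assms(1)
proof (induction As)
  case (Cons A As)
  then show ?case using assms(2)
    by (simp add: add_mult_distrib_mat[of _ d d _ _ d] mat_sum_carrier)
qed (use assms(2) in simp)

lemma sandwich_carrier:
  "\<lbrakk> A \<in> carrier_mat d d; R \<in> carrier_mat d d \<rbrakk> \<Longrightarrow> sandwich A R \<in> carrier_mat d d"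
  unfolding sandwich_def by (metis mat_adjoint_carrier mult_carrier_mat)

text \<open>Cyclicity of the trace moves the adjoint to the front. After this step a family of
  operators enters only through its products \<open>mat_adjoint A * A\<close>, which is what
  completeness speaks about.\<close>

lemma mat_trace_sandwich:
  assumes "A \<in> carrier_mat d d" "R \<in> carrier_mat d d"
  shows "mat_trace (sandwich A R) = mat_trace ((mat_adjoint A * A) * R)"
proof -
  have "mat_trace (sandwich A R) = mat_trace (mat_adjoint A * (A * R))"
    unfolding sandwich_def by (rule mat_trace_mult_commute[of _ d d]) (use assms in auto)
  also have "mat_adjoint A * (A * R) = (mat_adjoint A * A) * R"
    by (rule assoc_mult_mat[symmetric, of _ d d _ d _ d]) (use assms in auto)
  finally show ?thesis .
qed

text \<open>By linearity the traces collect into the trace of \<open>R\<close> multiplied by the sum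
  of all \<open>mat_adjoint A * A\<close>, and completeness makes this sum the identity. It serves
  both for trace preservation and for outcome probabilities.\<close>

lemma sum_mat_trace_sandwich:
  assumes "complete_family n As" "R \<in> carrier_mat (2 ^ n) (2 ^ n)"
  shows "(\<Sum>A\<leftarrow>As. mat_trace (sandwich A R)) = mat_trace R"
proof -
  define B where "B = (\<lambda>A::complex mat. mat_adjoint A * A)"
  have As: "A \<in> carrier_mat (2 ^ n) (2 ^ n)" if "A \<in> set As" for A
    using that assms(1) by (auto simp: complete_family_def)
  then have B: "set (map B As) \<subseteq> carrier_mat (2 ^ n) (2 ^ n)"
    unfolding B_def by (force intro: mult_carrier_mat)
  have "(\<Sum>A\<leftarrow>As. mat_trace (sandwich A R)) = (\<Sum>A\<leftarrow>map (\<lambda>A. B A * R) As. mat_trace A)"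
    using As assms(2) by (auto simp: mat_trace_sandwich[where d = "2 ^ n"] B_def o_def intro!: arg_cong[where f = sum_list])
  also have "\<dots> = mat_trace (mat_sum (2 ^ n) (map (\<lambda>A. A * R) (map B As)))"
    using B assms(2) by (subst mat_trace_sum) (auto simp: o_def)
  also have "\<dots> = mat_trace (mat_sum (2 ^ n) (map B As) * R)"
    using B assms(2) by (simp only: mat_sum_mult_right)
  also have "mat_sum (2 ^ n) (map B As) = 1\<^sub>m (2 ^ n)"
    using assms(1) by (simp add: complete_family_def B_def)
  finally show ?thesis using assms(2) by simp
qed

text \<open>A density operator without the normalization of the trace: single Kraus terms and
  unnormalized measurement branches satisfy only this.\<close>

definition psd :: "nat \<Rightarrow> complex mat \<Rightarrow> bool" where
  "psd d A \<longleftrightarrow> A \<in> carrier_mat d d \<and> (\<forall>v \<in> carrier_vec d. 0 \<le> (A *\<^sub>v v) \<bullet>c v)"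

lemma density_operator_iff_psd: "density_operator d A \<longleftrightarrow> psd d A \<and> mat_trace A = 1"
  by (auto simp: density_operator_def psd_def)

lemma psd_smult:
  assumes "0 \<le> c" "psd d A"
  shows "psd d (complex_of_real c \<cdot>\<^sub>m A)"
proof -
  have "(complex_of_real c \<cdot>\<^sub>m A *\<^sub>v v) \<bullet>c v = complex_of_real c * ((A *\<^sub>v v) \<bullet>c v)"
    if "v \<in> carrier_vec d" for v
    using assms(2) that
    by (auto simp: psd_def scalar_prod_def sum_distrib_left sum_distrib_right mult_ac intro!: sum.cong)
  with assms show ?thesis by (auto simp: psd_def less_eq_complex_def)
qed

lemma psd_add: "\<lbrakk> psd d A; psd d B \<rbrakk> \<Longrightarrow> psd d (A + B)"
  unfolding psd_def
  by (auto simp: add_mult_distrib_mat_vec[of _ d d] add_scalar_prod_distrib[of _ d])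

lemma psd_mat_sum: "\<forall>A \<in> set As. psd d A \<Longrightarrow> psd d (mat_sum d As)"
proof (induction As)
  case Nil
  have "0\<^sub>m d d *\<^sub>v v = 0\<^sub>v d" if "v \<in> carrier_vec d" for v :: "complex vec"
    using that by (intro eq_vecI) auto
  then show ?case by (auto simp: psd_def)
qed (simp add: psd_add)

lemma adjoint_inner_prod:
  fixes A :: "complex mat"
  assumes "A \<in> carrier_mat n m" "v \<in> carrier_vec m" "w \<in> carrier_vec n"
  shows "(A *\<^sub>v v) \<bullet>c w = v \<bullet>c (mat_adjoint A *\<^sub>v w)"
proof -
  have "(A *\<^sub>v v) \<bullet>c w = (\<Sum>i<n. \<Sum>j<m. A $$ (i, j) * v $ j * cnj (w $ i))"
    using assms by (auto simp: scalar_prod_def atLeast0LessThan sum_distrib_right intro!: sum.cong)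
  also have "\<dots> = (\<Sum>j<m. \<Sum>i<n. A $$ (i, j) * v $ j * cnj (w $ i))"
    by (rule sum.swap)
  also have "\<dots> = v \<bullet>c (mat_adjoint A *\<^sub>v w)"
    using assms
    by (auto simp: scalar_prod_def atLeast0LessThan sum_distrib_left mult_ac intro!: sum.cong)
  finally show ?thesis .
qed

text \<open>The quadratic form of the sandwich at \<open>v\<close> is the quadratic form of
  \<open>R\<close> at \<open>mat_adjoint A *\<^sub>v v\<close>.\<close>

lemma psd_sandwich:
  assumes "A \<in> carrier_mat d d" "psd d R"
  shows "psd d (sandwich A R)"
  unfolding psd_def
proof (intro conjI ballI)
  have R: "R \<in> carrier_mat d d" using assms(2) by (simp add: psd_def)
  show "sandwich A R \<in> carrier_mat d d" using assms(1) R by (rule sandwich_carrier)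
  fix v :: "complex vec" assume v: "v \<in> carrier_vec d"
  let ?w = "mat_adjoint A *\<^sub>v v"
  have w: "?w \<in> carrier_vec d" using assms(1) v by (metis mat_adjoint_carrier mult_mat_vec_carrier)
  have "sandwich A R *\<^sub>v v = A *\<^sub>v (R *\<^sub>v ?w)"
  proof -
    have "sandwich A R *\<^sub>v v = A * R *\<^sub>v ?w"
      unfolding sandwich_def
      by (rule assoc_mult_mat_vec[of _ d d _ d]) (use assms(1) R v in \<open>auto intro: mult_carrier_mat\<close>)
    also have "\<dots> = A *\<^sub>v (R *\<^sub>v ?w)"
      by (rule assoc_mult_mat_vec[OF assms(1) R w])
    finally show ?thesis .
  qed
  then have "(sandwich A R *\<^sub>v v) \<bullet>c v = (R *\<^sub>v ?w) \<bullet>c ?w"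
    using adjoint_inner_prod[of A d d "R *\<^sub>v ?w" v] assms(1) R v w by simp
  then show "0 \<le> (sandwich A R *\<^sub>v v) \<bullet>c v" using assms(2) w by (simp add: psd_def)
qed

text \<open>Each diagonal entry is the value of the quadratic form at a standard basis
  vector.\<close>

lemma psd_trace_nonneg:
  assumes "psd d A"
  shows "0 \<le> mat_trace A"
proof -
  have A: "A \<in> carrier_mat d d" using assms by (simp add: psd_def)
  have "0 \<le> A $$ (i, i)" if i: "i < d" for i
  proof -
    have "(A *\<^sub>v unit_vec d i) \<bullet>c unit_vec d i = A $$ (i, i)"
    proof -
      have "conjugate (unit_vec d i) = (unit_vec d i :: complex vec)"
        by (rule eq_vecI) (auto simp: unit_vec_def)
      then show ?thesis using A i by simp
    qed
    then show ?thesis using assms by (metis psd_def unit_vec_carrier)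
  qed
  then show ?thesis using A by (auto simp: mat_trace_def intro!: sum_nonneg)
qed


section \<open>Operators on a tuple of qubits\<close>

text \<open>Positions count from the least significant bit, so the largest name in \<open>S\<close>
  has position \<open>0\<close>.\<close>

definition qubit_pos :: "qubit set \<Rightarrow> qubit \<Rightarrow> nat" where
  "qubit_pos S q = card {r \<in> S. q < r}"

text \<open>The position strictly decreases as the name grows, hence is injective on
  \<open>S\<close>; its image lies in a set of the same finite size.\<close>

lemma bij_betw_qubit_pos:
  assumes "finite S"
  shows "bij_betw (qubit_pos S) S {..<card S}"
proof -
  have less: "qubit_pos S q' < qubit_pos S q" if "q < q'" "q' \<in> S" for q q'
    unfolding qubit_pos_def using assms that by (intro psubset_card_mono) auto
  have inj: "inj_on (qubit_pos S) S"
    by (rule inj_onI) (metis less less_irrefl linorder_neqE_nat)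
  moreover have "qubit_pos S ` S \<subseteq> {..<card S}"
    unfolding qubit_pos_def using assms by (auto intro!: psubset_card_mono)
  then have "qubit_pos S ` S = {..<card S}"
    by (intro card_subset_eq) (use inj in \<open>auto simp: card_image\<close>)
  ultimately show ?thesis by (simp add: bij_betw_def)
qed

lemma qubit_bit_eq: "qubit_bit S q k = of_bool (bit k (qubit_pos S q))"
  by (simp add: qubit_bit_def qubit_pos_def bit_iff_odd mod_2_eq_odd)

text \<open>A Horner sum starts with the least significant digit, whereas the first qubit of the
  tuple is the most significant one; hence \<open>rev qs\<close>. This form makes the bits of a
  tuple index directly readable.\<close>

lemma tuple_index_eq_horner_sum:
  "tuple_index S qs k = horner_sum of_bool 2 (map (\<lambda>q. bit k (qubit_pos S q)) (rev qs))"
proof -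
  have "tuple_index S qs k =
      (\<Sum>i<length qs. of_bool (bit k (qubit_pos S (rev qs ! (length qs - Suc i)))) * 2 ^ (length qs - Suc i))"
    unfolding tuple_index_def by (intro sum.cong) (auto simp: qubit_bit_eq rev_nth)
  also have "\<dots> = (\<Sum>i<length qs. of_bool (bit k (qubit_pos S (rev qs ! i))) * 2 ^ i)"
    by (rule sum.nat_diff_reindex)
  finally show ?thesis by (simp add: horner_sum_eq_sum atLeast0LessThan)
qed

lemma tuple_index_less: "tuple_index S qs k < 2 ^ length qs"
  using horner_sum_of_bool_2_less[of "map (\<lambda>q. bit k (qubit_pos S q)) (rev qs)"]
  by (simp add: tuple_index_eq_horner_sum)

lemma bit_tuple_index:
  "i < length qs \<Longrightarrow> bit (tuple_index S qs k) i = bit k (qubit_pos S (rev qs ! i))"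
  by (simp add: tuple_index_eq_horner_sum bit_horner_sum_bit_iff)

lemma nat_eq_if_bits_eq:
  fixes k l :: nat
  assumes "k < 2 ^ n" "l < 2 ^ n" "\<And>i. i < n \<Longrightarrow> bit k i = bit l i"
  shows "k = l"
proof -
  have "take_bit n k = take_bit n l"
    using assms(3) by (auto simp: bit_eq_iff bit_take_bit_iff)
  then show ?thesis using assms(1,2) by (simp add: take_bit_nat_eq_self)
qed

definition agree_off :: "qubit set \<Rightarrow> qubit list \<Rightarrow> nat \<Rightarrow> nat \<Rightarrow> bool" where
  "agree_off S qs k l \<longleftrightarrow> (\<forall>r \<in> S - set qs. qubit_bit S r k = qubit_bit S r l)"

lemma agree_off_iff:
  "agree_off S qs k l \<longleftrightarrow> (\<forall>r \<in> S - set qs. bit k (qubit_pos S r) = bit l (qubit_pos S r))"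
  by (auto simp: agree_off_def qubit_bit_eq)

text \<open>Every bit position belongs to some qubit of \<open>S\<close>. If the qubit lies in the
  tuple, the tuple index determines its bit; otherwise agreement off the tuple does.\<close>

lemma basis_index_eqI:
  assumes "finite S" "k < 2 ^ card S" "l < 2 ^ card S"
    and off: "agree_off S qs k l" and on: "tuple_index S qs k = tuple_index S qs l"
  shows "k = l"
proof (rule nat_eq_if_bits_eq[OF assms(2,3)])
  fix i assume "i < card S"
  then obtain q where q: "q \<in> S" "i = qubit_pos S q"
    using bij_betw_qubit_pos[OF assms(1)] by (auto simp: bij_betw_def)
  show "bit k i = bit l i"
  proof (cases "q \<in> set qs")
    case True
    then obtain j where "j < length qs" "q = rev qs ! j"
      by (metis in_set_conv_nth length_rev set_rev)
    then show ?thesis using bit_tuple_index[of j qs S] on q(2) by metis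
  qed (use off q in \<open>auto simp: agree_off_iff\<close>)
qed

text \<open>Fixing the bits off the tuple leaves those on the tuple free. Injectivity is
  \<open>basis_index_eqI\<close>; for surjectivity the bits of \<open>j\<close> are written at the
  tuple and those of \<open>k\<close> elsewhere, which is consistent because the names in
  \<open>qs\<close> are distinct.\<close>

lemma bij_betw_tuple_index:
  assumes S: "finite S" and qs: "distinct qs" "set qs \<subseteq> S"
  shows "bij_betw (tuple_index S qs) {l. l < 2 ^ card S \<and> agree_off S qs k l} {..<2 ^ length qs}"
  unfolding bij_betw_def
proof (intro conjI equalityI subsetI)
  show "inj_on (tuple_index S qs) {l. l < 2 ^ card S \<and> agree_off S qs k l}"
    by (rule inj_onI, rule basis_index_eqI[OF S, where qs = qs]) (simp_all add: agree_off_def)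
next
  fix j assume "j \<in> tuple_index S qs ` {l. l < 2 ^ card S \<and> agree_off S qs k l}"
  then show "j \<in> {..<2 ^ length qs}" by (auto simp: tuple_index_less)
next
  fix j :: nat assume j: "j \<in> {..<2 ^ length qs}"
  \<comment> \<open>The bit wanted at qubit \<open>q\<close>. Distinctness of \<open>qs\<close>
    makes the position picked by \<open>THE\<close> unique.\<close>
  define b where "b = (\<lambda>q. if q \<in> set qs then bit j (THE i. i < length qs \<and> rev qs ! i = q)
                                else bit k (qubit_pos S q))"
  \<comment> \<open>The basis index with these bits: position \<open>p\<close> belongs to the qubit
    that \<open>qubit_pos S\<close> sends to \<open>p\<close>.\<close>
  define l :: nat where
    "l = horner_sum of_bool 2 (map (\<lambda>p. b (inv_into S (qubit_pos S) p)) [0..<card S])"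
  have pos: "inj_on (qubit_pos S) S" "q \<in> S \<Longrightarrow> qubit_pos S q < card S" for q
    using bij_betw_qubit_pos[OF S] by (auto simp: bij_betw_def)
  have bit_l: "bit l (qubit_pos S q) = b q" if "q \<in> S" for q
    using that pos by (simp add: l_def bit_horner_sum_bit_iff)
  have "l < 2 ^ card S"
    unfolding l_def
    using horner_sum_of_bool_2_less[of "map (\<lambda>p. b (inv_into S (qubit_pos S) p)) [0..<card S]"]
    by simp
  moreover have "agree_off S qs k l" by (auto simp: agree_off_iff bit_l b_def)
  moreover have "tuple_index S qs l = j"
  proof (rule nat_eq_if_bits_eq)
    fix i assume i: "i < length qs"
    then have in_qs: "rev qs ! i \<in> set qs" by (metis length_rev nth_mem set_rev)
    have "(THE i'. i' < length qs \<and> rev qs ! i' = rev qs ! i) = i"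
      using i qs(1) by (intro the_equality) (auto simp: nth_eq_iff_index_eq[of "rev qs"])
    then show "bit (tuple_index S qs l) i = bit j i"
      using in_qs qs(2) i by (auto simp: bit_tuple_index bit_l b_def)
  qed (use j tuple_index_less in auto)
  ultimately show "j \<in> tuple_index S qs ` {l. l < 2 ^ card S \<and> agree_off S qs k l}" by blast
qed

section \<open>Completeness of operator families tensored with the identity\<close>

lemma on_qubits_carrier [simp]: "on_qubits S qs A \<in> carrier_mat (2 ^ card S) (2 ^ card S)"
  by (simp add: on_qubits_def)

lemma index_on_qubits:
  "\<lbrakk> k < 2 ^ card S; l < 2 ^ card S \<rbrakk> \<Longrightarrow> on_qubits S qs A $$ (k, l) =
    (if agree_off S qs k l then A $$ (tuple_index S qs k, tuple_index S qs l) else 0)"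
  by (simp add: on_qubits_def agree_off_def)

lemma index_adjoint_mult_self:
  fixes A :: "complex mat"
  assumes "A \<in> carrier_mat m n" "k < n" "l < n"
  shows "(mat_adjoint A * A) $$ (k, l) = (\<Sum>h<m. cnj (A $$ (h, k)) * A $$ (h, l))"
  using assms by (auto simp: scalar_prod_def atLeast0LessThan intro!: sum.cong)

text \<open>In the sum over the middle index \<open>h\<close> only those \<open>h\<close> contribute
  that agree with both \<open>k\<close> and \<open>l\<close> off the tuple. Agreement is an
  equivalence, so \<open>k\<close> and \<open>l\<close> must then agree, and \<open>h\<close> runs
  over one class, which \<open>bij_betw_tuple_index\<close> turns into the basis of the small
  space.\<close>

lemma index_on_qubits_adjoint_mult_self:
  assumes "finite S" "distinct qs" "set qs \<subseteq> S" "A \<in> carrier_mat (2 ^ length qs) (2 ^ length qs)"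
    and kl: "k < 2 ^ card S" "l < 2 ^ card S"
  shows "(mat_adjoint (on_qubits S qs A) * on_qubits S qs A) $$ (k, l) =
    (if agree_off S qs k l
     then (mat_adjoint A * A) $$ (tuple_index S qs k, tuple_index S qs l) else 0)"
proof -
  let ?i = "tuple_index S qs"
  let ?f = "\<lambda>h. cnj (A $$ (h, ?i k)) * A $$ (h, ?i l)"
  have "(mat_adjoint (on_qubits S qs A) * on_qubits S qs A) $$ (k, l) =
      (\<Sum>h<2 ^ card S. if agree_off S qs k l \<and> agree_off S qs k h then ?f (?i h) else 0)"
    using kl by (subst index_adjoint_mult_self[OF on_qubits_carrier kl])
      (auto simp: index_on_qubits agree_off_def intro!: sum.cong)
  also have "\<dots> = (if agree_off S qs k l then
      (\<Sum>h | h < 2 ^ card S \<and> agree_off S qs k h. ?f (?i h)) else 0)"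
    by (auto simp: sum.If_cases Int_def)
  also have "(\<Sum>h | h < 2 ^ card S \<and> agree_off S qs k h. ?f (?i h)) = (\<Sum>h<2 ^ length qs. ?f h)"
    by (rule sum.reindex_bij_betw[OF bij_betw_tuple_index[OF assms(1-3)]])
  also have "\<dots> = (mat_adjoint A * A) $$ (?i k, ?i l)"
    by (rule index_adjoint_mult_self[OF assms(4), symmetric]) (rule tuple_index_less)+
  finally show ?thesis .
qed

text \<open>Entrywise, the sum is the small identity read at the two tuple indices, provided that
  \<open>k\<close> and \<open>l\<close> agree off the tuple. By \<open>basis_index_eqI\<close> both
  conditions hold together exactly when \<open>k = l\<close>.\<close>

lemma complete_family_on_qubits:
  assumes "finite S" "distinct qs" "set qs \<subseteq> S" "complete_family (length qs) As"
  shows "complete_family (card S) (map (on_qubits S qs) As)"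
proof -
  let ?B = "\<lambda>A :: complex mat. mat_adjoint A * A"
  have As: "A \<in> carrier_mat (2 ^ length qs) (2 ^ length qs)" if "A \<in> set As" for A
    using assms(4) that by (auto simp: complete_family_def)
  have one: "mat_sum (2 ^ length qs) (map ?B As) = 1\<^sub>m (2 ^ length qs)"
    using assms(4) by (simp add: complete_family_def)
  have B: "set (map ?B As) \<subseteq> carrier_mat (2 ^ length qs) (2 ^ length qs)"
    using As by (force intro: mult_carrier_mat)
  have C: "set (map (?B \<circ> on_qubits S qs) As) \<subseteq> carrier_mat (2 ^ card S) (2 ^ card S)"
    by (auto intro!: mult_carrier_mat[of _ _ "2 ^ card S"])
  have "mat_sum (2 ^ card S) (map (?B \<circ> on_qubits S qs) As) = 1\<^sub>m (2 ^ card S)"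
  proof (rule eq_matI)
    fix k l assume "k < dim_row (1\<^sub>m (2 ^ card S) :: complex mat)"
      "l < dim_col (1\<^sub>m (2 ^ card S) :: complex mat)"
    then have kl: "k < 2 ^ card S" "l < 2 ^ card S" by simp_all
    have "mat_sum (2 ^ card S) (map (?B \<circ> on_qubits S qs) As) $$ (k, l) =
      (\<Sum>A\<leftarrow>As. ?B (on_qubits S qs A) $$ (k, l))"
      by (subst index_mat_sum[OF C kl]) (simp add: o_def)
    also have "\<dots> = (\<Sum>A\<leftarrow>As. if agree_off S qs k l
        then ?B A $$ (tuple_index S qs k, tuple_index S qs l) else 0)"
      using index_on_qubits_adjoint_mult_self[OF assms(1-3) _ kl] As
      by (intro arg_cong[where f = sum_list] map_cong) simp_all
    also have "\<dots> = (if agree_off S qs k l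
        then (\<Sum>A\<leftarrow>map ?B As. A $$ (tuple_index S qs k, tuple_index S qs l)) else 0)"
      by (simp add: o_def)
    also have "\<dots> = (if agree_off S qs k l \<and> tuple_index S qs k = tuple_index S qs l then 1 else 0)"
      by (simp only: index_mat_sum[OF B tuple_index_less tuple_index_less, symmetric] one)
        (simp add: tuple_index_less)
    also have "\<dots> = (1\<^sub>m (2 ^ card S) :: complex mat) $$ (k, l)"
      using basis_index_eqI[OF assms(1) kl] kl by (auto simp: agree_off_def)
    finally show "mat_sum (2 ^ card S) (map (?B \<circ> on_qubits S qs) As) $$ (k, l) =
      1\<^sub>m (2 ^ card S) $$ (k, l)" .
  qed (use mat_sum_carrier[OF C] in auto)
  then show ?thesis by (auto simp: complete_family_def o_def)
qed

section \<open>Density operators under superoperators and measurements\<close>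

lemma superop_complete: "complete_family (superop_arity \<E>) (kraus \<E>)"
  using Rep_superop[of \<E>] by (auto simp: superop_arity_def kraus_def)

lemma measurement_complete: "complete_family (meas_arity \<M>) (meas_ops \<M>)"
  using Rep_measurement[of \<M>] by (auto simp: meas_arity_def meas_ops_def)

lemma is_density_apply_superop:
  assumes "is_density \<rho>" "distinct qs" "set qs \<subseteq> qubits \<rho>" "length qs = superop_arity \<E>"
  shows "is_density (apply_superop \<E> qs \<rho>)"
proof -
  let ?S = "qubits \<rho>" and ?R = "op \<rho>"
  let ?Es = "map (on_qubits ?S qs) (kraus \<E>)"
  have fin: "finite ?S" and R: "psd (2 ^ card ?S) ?R" and tr: "mat_trace ?R = 1"
    using assms(1) by (auto simp: is_density_def density_operator_iff_psd)
  then have R': "?R \<in> carrier_mat (2 ^ card ?S) (2 ^ card ?S)" by (simp add: psd_def)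
  have E: "complete_family (card ?S) ?Es"
    using fin assms superop_complete[of \<E>] by (intro complete_family_on_qubits) auto
  have op: "op (apply_superop \<E> qs \<rho>) = mat_sum (2 ^ card ?S) (map (\<lambda>E. sandwich E ?R) ?Es)"
    by (simp add: apply_superop_def o_def)
  have "mat_trace (op (apply_superop \<E> qs \<rho>)) = (\<Sum>E\<leftarrow>?Es. mat_trace (sandwich E ?R))"
    unfolding op using R' by (subst mat_trace_sum) (auto intro!: sandwich_carrier simp: o_def)
  also have "\<dots> = 1" using sum_mat_trace_sandwich[OF E R'] tr by simp
  finally have "mat_trace (op (apply_superop \<E> qs \<rho>)) = 1" .
  moreover have "psd (2 ^ card ?S) (op (apply_superop \<E> qs \<rho>))"
    unfolding op using R by (intro psd_mat_sum) (auto intro: psd_sandwich)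
  ultimately show ?thesis
    using fin by (simp add: is_density_def density_operator_iff_psd) (simp add: apply_superop_def)
qed

lemma meas_branch_psd:
  "is_density \<rho> \<Longrightarrow> psd (2 ^ card (qubits \<rho>)) (meas_branch \<M> qs m \<rho>)"
  by (auto simp: meas_branch_def is_density_def density_operator_iff_psd intro: psd_sandwich)

text \<open>Nonnegativity in the order on \<open>complex\<close> forces the imaginary part to
  vanish, so taking \<open>Re\<close> in \<open>meas_prob\<close> loses nothing.\<close>

lemma trace_meas_branch:
  assumes "is_density \<rho>"
  shows "mat_trace (meas_branch \<M> qs m \<rho>) = complex_of_real (meas_prob \<M> qs m \<rho>)"
    and "0 \<le> meas_prob \<M> qs m \<rho>"
  using psd_trace_nonneg[OF meas_branch_psd[OF assms]]
  by (auto simp: meas_prob_def less_eq_complex_def complex_eq_iff)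

text \<open>Dividing by the trace restores normalization. At probability \<open>0\<close> the factor
  \<open>1 / 0\<close> would be \<open>0\<close> and the trace would not be
  \<open>1\<close>.\<close>

lemma is_density_meas_state:
  assumes "is_density \<rho>" "meas_prob \<M> qs m \<rho> \<noteq> 0"
  shows "is_density (meas_state \<M> qs m \<rho>)"
proof -
  note B = meas_branch_psd[OF assms(1), of \<M> qs m]
  have "psd (2 ^ card (qubits \<rho>)) (op (meas_state \<M> qs m \<rho>))"
    unfolding meas_state_def qstate.sel
    by (rule psd_smult[OF _ B]) (simp add: trace_meas_branch(2)[OF assms(1)])
  moreover have "mat_trace (op (meas_state \<M> qs m \<rho>)) = 1"
    using B assms(2)
    by (simp add: meas_state_def psd_def mat_trace_smult[where d = "2 ^ card (qubits \<rho>)"]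
        trace_meas_branch(1)[OF assms(1)])
  ultimately show ?thesis
    using assms(1) by (simp add: is_density_def density_operator_iff_psd) (simp add: meas_state_def)
qed

lemma sum_meas_prob:
  assumes "is_density \<rho>" "distinct qs" "set qs \<subseteq> qubits \<rho>" "length qs = meas_arity \<M>"
  shows "(\<Sum>m\<leftarrow>[0..<length (meas_ops \<M>)]. meas_prob \<M> qs m \<rho>) = 1"
proof -
  let ?S = "qubits \<rho>" and ?R = "op \<rho>"
  let ?Ms = "map (on_qubits ?S qs) (meas_ops \<M>)"
  have "finite ?S" and R: "?R \<in> carrier_mat (2 ^ card ?S) (2 ^ card ?S)" and tr: "mat_trace ?R = 1"
    using assms(1) by (auto simp: is_density_def density_operator_def)
  then have M: "complete_family (card ?S) ?Ms"
    using assms measurement_complete[of \<M>] by (intro complete_family_on_qubits) auto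
  have "map (\<lambda>m. meas_prob \<M> qs m \<rho>) [0..<length (meas_ops \<M>)] =
      map Re (map (\<lambda>A. mat_trace (sandwich A ?R)) ?Ms)"
    by (rule nth_equalityI) (auto simp: meas_prob_def meas_branch_def)
  moreover have "sum_list (map Re zs) = Re (sum_list zs)" for zs
    by (induction zs) auto
  ultimately show ?thesis
    by (simp only: sum_mat_trace_sandwich[OF M R] tr one_complex.sel)
qed


section \<open>Typing and substitution\<close>

text \<open>Every compound expression has type \<open>TBool\<close>, so only variables and values
  remain.\<close>

lemma expr_typed_TQubit:
  "expr_typed e TQubit \<longleftrightarrow> (\<exists>x. e = EVar x \<and> var_ty x = TQubit) \<or> (\<exists>q. e = EQubit q)"
  (is "?L \<longleftrightarrow> ?R")
proof
  have "T = TQubit \<Longrightarrow> ?R" if "expr_typed e T" for T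
    using that
  proof cases
    case (2 v)
    moreover assume "T = TQubit"
    ultimately show ?thesis by (cases v) auto
  qed auto
  then show "?L \<Longrightarrow> ?R" by blast
qed (metis expr_typed.intros(1,2) val_ty.simps(3))

lemma expr_typed_EVal: "expr_typed (EVal v) T \<longleftrightarrow> T = val_ty v"
  by (auto intro: expr_typed.intros elim: expr_typed.cases)

lemma eval_val_ty: "\<lbrakk> e \<Down> v; expr_typed e T \<rbrakk> \<Longrightarrow> val_ty v = T"
  by (induction arbitrary: T rule: eval.induct) (auto elim: expr_typed.cases)

lemma eval_EVal [simp]: "EVal v \<Down> w \<longleftrightarrow> w = v"
  by (auto intro: eval.intros elim: eval.cases)

lemma expr_typed_subst:
  "\<lbrakk> expr_typed e T; val_ty v = var_ty x \<rbrakk> \<Longrightarrow> expr_typed (expr_subst e v x) T"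
proof (induction rule: expr_typed.induct)
  case (1 y)
  then show ?case by (auto simp: expr_typed_EVal intro: expr_typed.intros(1))
qed (auto intro: expr_typed.intros)

section \<open>Free variables and contexts under substitution\<close>

lemma expr_fv_subst: "expr_fv (expr_subst e v x) = expr_fv e - {x}"
  by (induction e) auto

lemma fv_subst: "fv (subst P v x) = fv P - {x}"
  by (induction P) (auto simp: expr_fv_subst)

text \<open>The rule for sending a qubit does not check the type of the expression it sends, so a
  typable context may contain arbitrary expressions. This predicate leaves only quantum variables
  and qubit names, on which substitution acts as a mere renaming.\<close>

definition quantum_ctx :: "expr set \<Rightarrow> bool" where
  "quantum_ctx \<Sigma> \<longleftrightarrow> (\<forall>e \<in> \<Sigma>. expr_typed e TQubit)"

lemma quantum_ctx_simps [simp]: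
  "quantum_ctx (insert e \<Sigma>) \<longleftrightarrow> expr_typed e TQubit \<and> quantum_ctx \<Sigma>"
  "quantum_ctx (\<Sigma> \<union> \<Sigma>') \<longleftrightarrow> quantum_ctx \<Sigma> \<and> quantum_ctx \<Sigma>'"
  by (auto simp: quantum_ctx_def)

lemma quantum_ctx_mono: "\<lbrakk> quantum_ctx \<Sigma>; \<Sigma>' \<subseteq> \<Sigma> \<rbrakk> \<Longrightarrow> quantum_ctx \<Sigma>'"
  by (auto simp: quantum_ctx_def)

lemma expr_subst_atom:
  assumes "expr_typed e TQubit"
  shows "expr_subst e v x = (if e = EVar x then EVal v else e)"
  using assms by (auto simp: expr_typed_TQubit split: if_splits)

definition rename_ctx :: "val \<Rightarrow> var \<Rightarrow> expr set \<Rightarrow> expr set" where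
  "rename_ctx v x \<Sigma> = (\<lambda>e. expr_subst e v x) ` \<Sigma>"

lemma rename_ctx_fresh:
  assumes "quantum_ctx \<Sigma>" "EVar x \<notin> \<Sigma>"
  shows "rename_ctx v x \<Sigma> = \<Sigma>"
proof -
  have "expr_subst e v x = e" if "e \<in> \<Sigma>" for e
    using assms that by (auto simp: quantum_ctx_def expr_subst_atom)
  then show ?thesis by (simp add: rename_ctx_def)
qed

text \<open>Substitution can identify two elements of the context only if they are
  \<open>EVar x\<close> and \<open>EVal v\<close>.\<close>

lemma inj_on_expr_subst:
  assumes "quantum_ctx \<Sigma>" "EVar x \<notin> \<Sigma> \<or> EVal v \<notin> \<Sigma>"
  shows "inj_on (\<lambda>e. expr_subst e v x) \<Sigma>"
  using assms by (intro inj_onI) (auto simp: quantum_ctx_def expr_subst_atom split: if_splits)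

text \<open>Whether \<open>x\<close> is in the context is left open: it may be classical, already
  sent away, or owned by the other parallel component. The disjunction keeps the renaming injective,
  so it preserves the distinctness, differences and disjointness that the typing rules
  require.\<close>

lemma typed_subst:
  assumes "\<Sigma> \<turnstile> P" "quantum_ctx \<Sigma>" "EVar x \<notin> \<Sigma> \<or> EVal v \<notin> \<Sigma>" "val_ty v = var_ty x"
  shows "rename_ctx v x \<Sigma> \<turnstile> subst P v x"
  using assms
proof (induction rule: typed.induct)
  case (typed_Zero es \<Sigma>)
  then have "inj_on (\<lambda>e. expr_subst e v x) (set es)" by (simp add: inj_on_expr_subst)
  with typed_Zero show ?case
    by (auto simp: distinct_map rename_ctx_def intro!: typed.typed_Zero expr_typed_subst)
next
  case (typed_Sop es \<E> \<Sigma> P t)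
  then have "inj_on (\<lambda>e. expr_subst e v x) (set es)"
    using inj_on_expr_subst inj_on_subset by blast
  with typed_Sop show ?case
    by (simp add: distinct_map rename_ctx_def typed.typed_Sop image_mono)
next
  case (typed_Meas es \<M> \<Sigma> y P t)
  then have "inj_on (\<lambda>e. expr_subst e v x) (set es)"
    using inj_on_expr_subst inj_on_subset by blast
  moreover have "rename_ctx v x \<Sigma> \<turnstile> (if y = x then P else subst P v x)"
  \<comment> \<open>If \<open>y\<close> shadows \<open>x\<close>, the continuation is left alone. As
    \<open>y\<close> is classical it is not in the context, so the context is unchanged too.\<close>
  proof (cases "y = x")
    case True
    then have "EVar x \<notin> \<Sigma>"
      using typed_Meas.prems(1) typed_Meas.hyps by (auto simp: quantum_ctx_def expr_typed_TQubit)
    then show ?thesis using True typed_Meas by (simp add: rename_ctx_fresh)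
  qed (use typed_Meas in simp)
  ultimately show ?case using typed_Meas.hyps
    by (simp add: distinct_map rename_ctx_def typed.typed_Meas image_mono)
next
  case (typed_Recv_classical c T y \<Sigma> P t)
  have "rename_ctx v x \<Sigma> \<turnstile> (if y = x then P else subst P v x)"
  proof (cases "y = x")
    case True
    then have "EVar x \<notin> \<Sigma>"
      using typed_Recv_classical.prems(1) typed_Recv_classical.hyps
      by (auto simp: quantum_ctx_def expr_typed_TQubit)
    then show ?thesis using True typed_Recv_classical by (simp add: rename_ctx_fresh)
  qed (use typed_Recv_classical in simp)
  then show ?case using typed_Recv_classical.hyps by (auto intro!: typed.typed_Recv_classical)
next
  case (typed_Recv_qubit c y \<Sigma> P t)
  have y: "expr_typed (EVar y) TQubit" using typed_Recv_qubit.hyps by (simp add: expr_typed_TQubit)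
  show ?case
  proof (cases "y = x")
    case True
    then show ?thesis using typed_Recv_qubit
      by (auto simp: rename_ctx_fresh intro!: typed.typed_Recv_qubit)
  next
    case False
    then have "rename_ctx v x (\<Sigma> \<union> {EVar y}) \<turnstile> subst P v x"
      using typed_Recv_qubit.prems y by (intro typed_Recv_qubit.IH) auto
    moreover have "rename_ctx v x (\<Sigma> \<union> {EVar y}) = rename_ctx v x \<Sigma> \<union> {EVar y}"
      using False by (auto simp: rename_ctx_def)
    \<comment> \<open>Renaming introduces at most the value \<open>v\<close>, never a variable, so
      the bound variable stays fresh.\<close>
    moreover have "EVar y \<notin> rename_ctx v x \<Sigma>"
      using typed_Recv_qubit.hyps typed_Recv_qubit.prems(1)
      by (auto simp: rename_ctx_def quantum_ctx_def expr_subst_atom split: if_splits)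
    ultimately show ?thesis using False typed_Recv_qubit.hyps
      by (auto intro!: typed.typed_Recv_qubit)
  qed
next
  case (typed_Send_classical c T e \<Sigma> P t)
  then show ?case by (auto intro!: typed.typed_Send_classical expr_typed_subst)
next
  case (typed_Send_qubit c e \<Sigma> P t)
  have "rename_ctx v x (\<Sigma> - {e}) \<turnstile> subst P v x"
    using typed_Send_qubit.prems by (intro typed_Send_qubit.IH) (auto intro: quantum_ctx_mono)
  \<comment> \<open>An injective image commutes with removing the sent element.\<close>
  moreover have "rename_ctx v x (\<Sigma> - {e}) = rename_ctx v x \<Sigma> - {expr_subst e v x}"
    using inj_on_image_set_diff[OF inj_on_expr_subst[of \<Sigma> x v], of \<Sigma> "{e}"] typed_Send_qubit
    by (simp add: rename_ctx_def)
  ultimately show ?case using typed_Send_qubit.hyps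
    by (auto simp: rename_ctx_def intro!: typed.typed_Send_qubit)
next
  case (typed_Par \<Sigma>1 \<Sigma>2 P Q)
  then have "inj_on (\<lambda>e. expr_subst e v x) (\<Sigma>1 \<union> \<Sigma>2)"
    by (intro inj_on_expr_subst) auto
  then have "rename_ctx v x \<Sigma>1 \<inter> rename_ctx v x \<Sigma>2 = rename_ctx v x (\<Sigma>1 \<inter> \<Sigma>2)"
    unfolding rename_ctx_def by (rule inj_on_image_Int[symmetric]) auto
  then have "rename_ctx v x \<Sigma>1 \<inter> rename_ctx v x \<Sigma>2 = {}"
    using typed_Par.hyps by (simp add: rename_ctx_def)
  moreover have "rename_ctx v x (\<Sigma>1 \<union> \<Sigma>2) = rename_ctx v x \<Sigma>1 \<union> rename_ctx v x \<Sigma>2"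
    by (auto simp: rename_ctx_def)
  ultimately show ?case using typed_Par by (auto intro!: typed.typed_Par)
qed (auto intro!: typed.intros expr_typed_subst)


section \<open>Transitions\<close>

text \<open>The probability of \<open>x\<close> is the sum of the weights listed with
  \<open>x\<close>; if all of them were \<open>0\<close>, it would not be in the support. Outcomes
  of probability \<open>0\<close>, whose states are not normalized, are excluded this way.\<close>

lemma set_pmf_of_list_weighted:
  assumes "pmf_of_list_wf xs" "x \<in> set_pmf (pmf_of_list xs)"
  shows "\<exists>p. (x, p) \<in> set xs \<and> p \<noteq> 0"
proof (rule ccontr)
  assume "\<not> ?thesis"
  then have "sum_list (map snd (filter (\<lambda>z. fst z = x) xs)) = 0"
    by (intro sum_list_neutral) fastforce
  then show False using assms by (simp add: pmf_pmf_of_list set_pmf_iff)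
qed

text \<open>The distribution of the measurement rule with the continuation abstracted to a function
  of the outcome, so that its support can be studied apart from substitution.\<close>

definition meas_dist :: "measurement \<Rightarrow> qubit list \<Rightarrow> (nat \<Rightarrow> proc) \<Rightarrow> qstate \<Rightarrow> conf pmf" where
  "meas_dist \<M> qs P \<rho> = pmf_of_list
     (map (\<lambda>m. (\<langle>meas_state \<M> qs m \<rho>, P m\<rangle>, meas_prob \<M> qs m \<rho>)) [0..<length (meas_ops \<M>)])"

lemma meas_dist_support:
  assumes "is_density \<rho>" "distinct qs" "set qs \<subseteq> qubits \<rho>" "length qs = meas_arity \<M>"
  shows "finite (set_pmf (meas_dist \<M> qs P \<rho>))"
    and "C \<in> set_pmf (meas_dist \<M> qs P \<rho>) \<Longrightarrow>
      \<exists>m. C = \<langle>meas_state \<M> qs m \<rho>, P m\<rangle> \<and> is_density (meas_state \<M> qs m \<rho>)"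
proof -
  let ?xs = "map (\<lambda>m. (\<langle>meas_state \<M> qs m \<rho>, P m\<rangle>, meas_prob \<M> qs m \<rho>)) [0..<length (meas_ops \<M>)]"
  have wf: "pmf_of_list_wf ?xs"
    using sum_meas_prob[OF assms] trace_meas_branch(2)[OF assms(1)]
    by (intro pmf_of_list_wfI) (auto simp: o_def)
  then show "finite (set_pmf (meas_dist \<M> qs P \<rho>))"
    unfolding meas_dist_def by (rule finite_set_pmf_of_list)
  show "\<exists>m. C = \<langle>meas_state \<M> qs m \<rho>, P m\<rangle> \<and> is_density (meas_state \<M> qs m \<rho>)"
    if "C \<in> set_pmf (meas_dist \<M> qs P \<rho>)"
    using set_pmf_of_list_weighted[OF wf] that is_density_meas_state[OF assms(1)]
    by (force simp: meas_dist_def)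
qed

lemma qubit_tuple:
  assumes "set (map EQubit qs) \<subseteq> \<Sigma>" "\<Sigma> \<subseteq> EQubit ` S" "distinct (map EQubit qs)"
  shows "set qs \<subseteq> S" "distinct qs"
  using assms by (auto simp: distinct_map)

section \<open>The effect of actions on contexts\<close>

fun ctx_after :: "act \<Rightarrow> expr set \<Rightarrow> expr set" where
  "ctx_after ATau \<Sigma> = \<Sigma>"
| "ctx_after (AOut c v) \<Sigma> = (if chan_ty c = TQubit then \<Sigma> - {EVal v} else \<Sigma>)"
| "ctx_after (AIn c v) \<Sigma> = (if chan_ty c = TQubit then insert (EVal v) \<Sigma> else \<Sigma>)"

text \<open>Ownership of qubits: a sender must own the qubit that it sends, and a receiver must not
  own it yet.\<close>

fun act_typed :: "act \<Rightarrow> expr set \<Rightarrow> bool" where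
  "act_typed ATau \<Sigma> = True"
| "act_typed (AOut c v) \<Sigma> = (val_ty v = chan_ty c \<and> (chan_ty c = TQubit \<longrightarrow> EVal v \<in> \<Sigma>))"
| "act_typed (AIn c v) \<Sigma> = (val_ty v = chan_ty c \<and> (chan_ty c = TQubit \<longrightarrow> EVal v \<notin> \<Sigma>))"

fun is_input :: "act \<Rightarrow> bool" where
  "is_input (AIn c v) = True"
| "is_input \<mu> = False"

text \<open>Contexts stay sets of expressions, and their inclusion in the qubits of the state is
  left out: a \<tau>-action does not change the context, so the inclusion need only be known
  beforehand.\<close>

definition residual_ok :: "qubit set \<Rightarrow> expr set \<Rightarrow> conf \<Rightarrow> bool" where
  "residual_ok S \<Sigma> C \<longleftrightarrow>
     is_density (state C) \<and> qubits (state C) = S \<and> fv (proc C) = {} \<and> \<Sigma> \<turnstile> proc C"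

text \<open>The context is arbitrary in the induction because each parallel component is typed by
  only a part of it. As it consists of qubit names, no variable occurs in it, and substitution of a
  classical value leaves it fixed.\<close>

lemma step_typed:
  assumes "step C \<mu> s \<Delta>" "residual_ok S \<Sigma> C" "\<Sigma> \<subseteq> EQubit ` S"
    "is_input \<mu> \<longrightarrow> act_typed \<mu> \<Sigma>"
  shows "act_typed \<mu> \<Sigma> \<and> finite (set_pmf \<Delta>) \<and>
    (\<forall>C' \<in> set_pmf \<Delta>. residual_ok S (ctx_after \<mu> \<Sigma>) C')"
  using assms
proof (induction arbitrary: \<Sigma> rule: step.induct)
  case (step_Send e v \<rho> t c P)
  then have "\<Sigma> \<turnstile> Send t c e P" by (simp add: residual_ok_def)
  then show ?case
  proof (cases rule: typed_SendE[consumes 1, case_names classical qubit])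
    case classical
    then show ?thesis using classical step_Send.hyps step_Send.prems eval_val_ty by (auto simp: residual_ok_def)
  next
    case qubit
    \<comment> \<open>An expression in the context is a literal name and evaluates to itself, so the
      value sent is exactly what typing removes.\<close>
    moreover obtain q where "e = EQubit q" using qubit step_Send.prems by auto
    ultimately show ?thesis using qubit step_Send by (auto simp: residual_ok_def)
  qed
next
  case (step_Recv c v \<rho> t x P)
  then have "\<Sigma> \<turnstile> Recv t c x P" by (simp add: residual_ok_def)
  have q: "quantum_ctx \<Sigma>" and x: "EVar y \<notin> \<Sigma>" for y
    using step_Recv.prems by (auto simp: quantum_ctx_def expr_typed_TQubit)
  have v: "val_ty v = chan_ty c" "chan_ty c = TQubit \<longrightarrow> EVal v \<notin> \<Sigma>"
    using step_Recv.prems by auto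
  from \<open>\<Sigma> \<turnstile> Recv t c x P\<close> have "ctx_after (AIn c v) \<Sigma> \<turnstile> subst P v x"
  proof (cases rule: typed_RecvE[consumes 1, case_names classical qubit])
    case classical
    then show ?thesis using typed_subst[of \<Sigma> P x v] q x v by (auto simp: rename_ctx_fresh)
  next
    case qubit
    \<comment> \<open>Here \<open>x\<close> is in the context, so injectivity rests on
      \<open>v\<close> not being owned yet; the renaming replaces \<open>x\<close> by
      \<open>v\<close>.\<close>
    then have "rename_ctx v x (\<Sigma> \<union> {EVar x}) \<turnstile> subst P v x"
      using q x v by (intro typed_subst) (auto simp: expr_typed_TQubit)
    moreover have "rename_ctx v x (\<Sigma> \<union> {EVar x}) = insert (EVal v) \<Sigma>"
      using rename_ctx_fresh[OF q x, of v x] by (simp add: rename_ctx_def)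
    ultimately show ?thesis using qubit by simp
  qed
  then show ?case using step_Recv.prems v by (auto simp: residual_ok_def fv_subst)
next
  case (step_Sop \<rho> t \<E> qs P)
  then have "\<Sigma> \<turnstile> Sop t \<E> (map EQubit qs) P" by (simp add: residual_ok_def)
  then show ?case
  proof (cases rule: typed_SopE[consumes 1])
    case 1
    then have "is_density (apply_superop \<E> qs \<rho>)"
      using step_Sop.prems qubit_tuple[of qs \<Sigma> S]
      by (intro is_density_apply_superop) (auto simp: residual_ok_def)
    then show ?thesis using 1 step_Sop.prems
      by (auto simp: residual_ok_def apply_superop_def)
  qed
next
  case (step_Meas \<rho> t \<M> qs y P)
  then have "\<Sigma> \<turnstile> Meas t \<M> (map EQubit qs) y P" by (simp add: residual_ok_def)
  then show ?case
  proof (cases rule: typed_MeasE[consumes 1])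
    case 1
    let ?D = "meas_dist \<M> qs (\<lambda>m. subst P (VNat m) y) \<rho>"
    have q: "quantum_ctx \<Sigma>" and "EVar y \<notin> \<Sigma>"
      using step_Meas.prems by (auto simp: quantum_ctx_def expr_typed_TQubit)
    then have typed: "\<Sigma> \<turnstile> subst P (VNat m) y" for m
      using typed_subst[of \<Sigma> P y "VNat m"] 1 by (simp add: rename_ctx_fresh)
    have closed: "fv (subst P (VNat m) y) = {}" for m
      using step_Meas.prems by (auto simp: residual_ok_def fv_subst)
    have density: "is_density \<rho>" "qubits \<rho> = S"
      using step_Meas.prems by (auto simp: residual_ok_def)
    have qs: "distinct qs" "set qs \<subseteq> qubits \<rho>" "length qs = meas_arity \<M>"
      using 1 qubit_tuple[of qs \<Sigma> S] step_Meas.prems(2) density(2) by auto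
    have "finite (set_pmf ?D)"
      by (rule meas_dist_support(1)[OF density(1) qs])
    moreover have "residual_ok S \<Sigma> C" if "C \<in> set_pmf ?D" for C
      using meas_dist_support(2)[OF density(1) qs that] density(2) typed closed
      by (auto simp: residual_ok_def meas_state_def)
    ultimately have "finite (set_pmf ?D) \<and> (\<forall>C \<in> set_pmf ?D. residual_ok S \<Sigma> C)" by blast
    then show ?thesis by (simp add: meas_dist_def)
  qed
next
  case (step_Res \<rho> P \<mu> s \<Delta> c)
  then have "\<Sigma> \<turnstile> P" by (auto simp: residual_ok_def elim: typed_ResE)
  then show ?case using step_Res.IH[of \<Sigma>] step_Res.prems
    by (auto simp: residual_ok_def res_conf_def intro: typed.intros)
next
  case (step_Par_left \<rho> P \<mu> s \<Delta> Q)
  have "\<Sigma> \<turnstile> Par P Q" using step_Par_left.prems by (simp add: residual_ok_def)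
  then show ?case
  proof (cases rule: typed_ParE[consumes 1])
    case (1 \<Sigma>1 \<Sigma>2)
    have Q: "ctx Q = \<Sigma>2" using 1 ctx_eq by blast
    have "act_typed \<mu> \<Sigma>1 \<and> finite (set_pmf \<Delta>) \<and>
      (\<forall>C' \<in> set_pmf \<Delta>. residual_ok S (ctx_after \<mu> \<Sigma>1) C')"
      using step_Par_left.prems 1 by (intro step_Par_left.IH) (cases \<mu>; auto simp: residual_ok_def)+
    \<comment> \<open>An output only shrinks \<Sigma>1; a qubit that is input lies outside \<Sigma>2
      by \<open>input_avoids\<close>.\<close>
    moreover have "ctx_after \<mu> \<Sigma>1 \<inter> \<Sigma>2 = {}"
      using 1 step_Par_left.hyps Q by (cases \<mu>) (auto simp: input_avoids_def)
    \<comment> \<open>For an output, the qubit is in \<Sigma>1 and so not in \<Sigma>2; removing it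
      from the union therefore leaves \<Sigma>2 intact.\<close>
    moreover have "act_typed \<mu> \<Sigma>1 \<Longrightarrow> ctx_after \<mu> \<Sigma> = ctx_after \<mu> \<Sigma>1 \<union> \<Sigma>2"
      using 1 by (cases \<mu>) auto
    moreover have "act_typed \<mu> \<Sigma>1 \<Longrightarrow> act_typed \<mu> \<Sigma>"
      using 1 step_Par_left.hyps Q by (cases \<mu>) (auto simp: input_avoids_def)
    ultimately show ?thesis using 1 step_Par_left.prems
      by (auto simp: residual_ok_def par_left_def intro: typed.intros)
  qed
next
  case (step_Par_right \<rho> Q \<mu> s \<Delta> P)
  have "\<Sigma> \<turnstile> Par P Q" using step_Par_right.prems by (simp add: residual_ok_def)
  then show ?case
  proof (cases rule: typed_ParE[consumes 1])
    case (1 \<Sigma>1 \<Sigma>2)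
    have P: "ctx P = \<Sigma>1" using 1 ctx_eq by blast
    have "act_typed \<mu> \<Sigma>2 \<and> finite (set_pmf \<Delta>) \<and>
      (\<forall>C' \<in> set_pmf \<Delta>. residual_ok S (ctx_after \<mu> \<Sigma>2) C')"
      using step_Par_right.prems 1 by (intro step_Par_right.IH) (cases \<mu>; auto simp: residual_ok_def)+
    moreover have "\<Sigma>1 \<inter> ctx_after \<mu> \<Sigma>2 = {}"
      using 1 step_Par_right.hyps P by (cases \<mu>) (auto simp: input_avoids_def)
    moreover have "act_typed \<mu> \<Sigma>2 \<Longrightarrow> ctx_after \<mu> \<Sigma> = \<Sigma>1 \<union> ctx_after \<mu> \<Sigma>2"
      using 1 by (cases \<mu>) auto
    moreover have "act_typed \<mu> \<Sigma>2 \<Longrightarrow> act_typed \<mu> \<Sigma>"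
      using 1 step_Par_right.hyps P by (cases \<mu>) (auto simp: input_avoids_def)
    ultimately show ?thesis using 1 step_Par_right.prems
      by (auto simp: residual_ok_def par_right_def intro: typed.intros)
  qed
next
  case (step_Comm_left \<rho> P c v t P' Q t' Q')
  have "\<Sigma> \<turnstile> Par P Q" using step_Comm_left.prems by (simp add: residual_ok_def)
  then show ?case
  proof (cases rule: typed_ParE[consumes 1])
    case (1 \<Sigma>1 \<Sigma>2)
    have out: "act_typed (AOut c v) \<Sigma>1 \<and> residual_ok S (ctx_after (AOut c v) \<Sigma>1) \<langle>\<rho>, P'\<rangle>"
      using step_Comm_left.IH(1)[of \<Sigma>1] step_Comm_left.prems 1 by (auto simp: residual_ok_def)
    \<comment> \<open>The sender has just been shown to own a sent qubit, so disjointness keeps it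
      out of the receiver's context.\<close>
    moreover have "act_typed (AIn c v) \<Sigma>2" using out 1 by auto
    then have "residual_ok S (ctx_after (AIn c v) \<Sigma>2) \<langle>\<rho>, Q'\<rangle>"
      using step_Comm_left.IH(2)[of \<Sigma>2] step_Comm_left.prems 1 by (auto simp: residual_ok_def)
    \<comment> \<open>The qubit moves from \<Sigma>1 to \<Sigma>2: the two parts stay disjoint and
      their union is unchanged.\<close>
    moreover have "ctx_after (AOut c v) \<Sigma>1 \<inter> ctx_after (AIn c v) \<Sigma>2 = {}"
      "ctx_after (AOut c v) \<Sigma>1 \<union> ctx_after (AIn c v) \<Sigma>2 = \<Sigma>"
      using out 1 by auto
    ultimately show ?thesis using typed_Par[of "ctx_after (AOut c v) \<Sigma>1" "ctx_after (AIn c v) \<Sigma>2" P' Q']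
      by (auto simp: residual_ok_def simp del: ctx_after.simps(2,3))
  qed
next
  case (step_Comm_right \<rho> P c v t P' Q t' Q')
  have "\<Sigma> \<turnstile> Par Q P" using step_Comm_right.prems by (simp add: residual_ok_def)
  then show ?case
  proof (cases rule: typed_ParE[consumes 1])
    \<comment> \<open>The names are swapped so that \<Sigma>1 is again the context of the sender
      \<open>P\<close>, now the right component.\<close>
    case (1 \<Sigma>2 \<Sigma>1)
    have out: "act_typed (AOut c v) \<Sigma>1 \<and> residual_ok S (ctx_after (AOut c v) \<Sigma>1) \<langle>\<rho>, P'\<rangle>"
      using step_Comm_right.IH(1)[of \<Sigma>1] step_Comm_right.prems 1 by (auto simp: residual_ok_def)
    moreover have "act_typed (AIn c v) \<Sigma>2" using out 1 by auto
    then have "residual_ok S (ctx_after (AIn c v) \<Sigma>2) \<langle>\<rho>, Q'\<rangle>"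
      using step_Comm_right.IH(2)[of \<Sigma>2] step_Comm_right.prems 1 by (auto simp: residual_ok_def)
    moreover have "ctx_after (AIn c v) \<Sigma>2 \<inter> ctx_after (AOut c v) \<Sigma>1 = {}"
      "ctx_after (AIn c v) \<Sigma>2 \<union> ctx_after (AOut c v) \<Sigma>1 = \<Sigma>"
      using out 1 by auto
    ultimately show ?thesis using typed_Par[of "ctx_after (AIn c v) \<Sigma>2" "ctx_after (AOut c v) \<Sigma>1" Q' P']
      by (auto simp: residual_ok_def simp del: ctx_after.simps(2,3))
  qed
qed (auto simp: residual_ok_def elim: typed_TauE typed_TauPairE typed_CondE typed_ChoiceE)

theorem theorem1:
  fixes \<rho> :: qstate and P :: proc and s :: sched and \<Delta> :: "conf pmf"
    and \<Sigma>\<^sub>\<rho> \<Sigma>\<^sub>P :: "qubit set"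
  assumes "conf_typed \<Sigma>\<^sub>\<rho> \<Sigma>\<^sub>P \<langle>\<rho>, P\<rangle>"
    and "step \<langle>\<rho>, P\<rangle> ATau s \<Delta>"
  shows "dist_typed \<Sigma>\<^sub>\<rho> \<Sigma>\<^sub>P \<Delta>"
proof -
  have "residual_ok \<Sigma>\<^sub>\<rho> (EQubit ` \<Sigma>\<^sub>P) \<langle>\<rho>, P\<rangle>" "\<Sigma>\<^sub>P \<subseteq> \<Sigma>\<^sub>\<rho>"
    using assms(1) by (auto simp: conf_typed_def residual_ok_def closed_proc_def)
  then show ?thesis
    using step_typed[OF assms(2), of \<Sigma>\<^sub>\<rho> "EQubit ` \<Sigma>\<^sub>P"]
    by (auto simp: dist_typed_def conf_typed_def residual_ok_def closed_proc_def)
qed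

end
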